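(* Let $\alpha>-\frac12$. For all $f\in\mathcal{D}_q(\mathbb{R}_q)$ and all $x\in\mathbb{R}_q$, $${}^tV_{\alpha,q}(f)(x)={}^tR_{\alpha,q}(f_e)(x)+\partial_q\big[{}^tR_{\alpha,q}J_q(f_o)\big](x),$$ where $J_q(f_o)(x)=\int_{-\infty}^{qx}f_o(t)\,d_qt$.
   Context: Standing assumptions: $q\in(0,1)$ and $\frac{\log(1-q)}{\log q}\in 2\mathbb{Z}$. Functions are complex-valued. $\mathbb{R}_q=\{\pm q^n: n\in\mathbb{Z}\}$; $f_e,f_o$ are the even and odd parts of $f$. Notation: $(a;q)_\infty=\prod_{k\ge0}(1-aq^k)$, $\Gamma_{q^2}(x)=\frac{(q^2;q^2)_\infty}{(q^{2x};q^2)_\infty}(1-q^2)^{1-x}$. $q$-Jackson integrals, for $a\in\{q^n:n\in\mathbb{Z}\}$: $\int_a^\infty f(x)d_qx=(1-q)a\sum_{n=-\infty}^{-1}q^nf(aq^n)$, $\int_{-\infty}^{-a}f(x)d_qx=\int_a^\infty f(-x)d_qx$, $\int_0^{a}f(x)d_qx=(1-q)a\sum_{n\ge0}q^nf(aq^n)$, $\int_{-\infty}^0f(x)d_qx=(1-q)\sum_{n\in\mathbb{Z}}q^nf(-q^n)$, and $\int_{-\infty}^a=\int_{-\infty}^0+\int_0^a$. For $z\neq0$, $\partial_q f(z)=\frac{f(q^{-1}z)+f(-q^{-1}z)-f(qz)+f(-qz)-2f(-z)}{2(1-q)z}$. $\mathcal{E}_q(\mathbb{R}_q)$ is the space of functions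 $f$ on $\mathbb{R}_q$ such that for all $n\in\mathbb{N}$, $a\ge0$, $\sup\{|\partial_q^kf(x)|:0\le k\le n,\ x\in[-a,a]\cap\mathbb{R}_q\}<\infty$ and $\lim_{x\to0,x\in\mathbb{R}_q}\partial_q^nf(x)$ exists. $\mathcal{D}_q(\mathbb{R}_q)$ is the space of $f\in\mathcal{E}_q(\mathbb{R}_q)$ with compact support, i.e. vanishing for $|x|$ large; $\mathcal{D}_{*,q}(\mathbb{R}_q)$ is its subspace of even functions. $W_\alpha(t;q^2)=\frac{(t^2q^2;q^2)_\infty}{(t^2q^{2\alpha+1};q^2)_\infty}$. $q$-Weyl operator: for $f\in\mathcal{D}_{*,q}(\mathbb{R}_q)$, ${}^tR_{\alpha,q}(f)(t)=\frac{(1+q)^{-\alpha+\frac12}}{\Gamma_{q^2}(\alpha+\frac12)}\int_{q|t|}^{+\infty}W_\alpha\left(\frac tx;q^2\right)f(x)x^{2\alpha}d_qx$, $t\in\mathbb{R}_q$. Dual intertwining operator: for $f\in\mathcal{D}_q(\mathbb{R}_q)$, $t\in\mathbb{R}_q$, $${}^tV_{\alpha,q}(f)(t)=\frac{(1+q)^{-\alpha+\frac12}}{2\Gamma_{q^2}(\alpha+\frac12)}\int_{|x|\ge q|t|}W_\alpha\!\left(\tfrac tx;q^2\right)\left(1+\tfrac tx\right)f(x)|x|^{2\alpha}d_qx,$$ where $\int_{|x|\ge q|t|}g(x)d_qx=\int_{q|t|}^\infty[g(x)+g(-x)]d_qx$ (by the convention above, the sums run over points with $|x|\ge|t|$). 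*)

theory Defs
  imports "HOL-Analysis.Analysis"
begin

text \<open>
  A function on the lattice \<open>Rq q\<close> is represented by a function of type \<open>real \<Rightarrow> complex\<close>
  whose values outside \<open>Rq q\<close> are irrelevant: every notion below, evaluated at points of
  \<open>Rq q\<close>, only uses values on \<open>Rq q\<close>.
\<close>

definition Rq :: "real \<Rightarrow> real set" where
  "Rq q = {x. \<exists>n::int. x = q powi n \<or> x = - (q powi n)}"

definition even_part :: "(real \<Rightarrow> complex) \<Rightarrow> real \<Rightarrow> complex" where
  "even_part f x = (f x + f (- x)) / 2"

definition odd_part :: "(real \<Rightarrow> complex) \<Rightarrow> real \<Rightarrow> complex" where
  "odd_part f x = (f x - f (- x)) / 2"

definition qpoch_inf :: "real \<Rightarrow> real \<Rightarrow> real" where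
  "qpoch_inf a q = (\<Prod>k. 1 - a * q ^ k)"

text \<open>The \<open>q\<close>-Gamma function with base \<open>q\<^sup>2\<close>.\<close>

definition qGamma2 :: "real \<Rightarrow> real \<Rightarrow> real" where
  "qGamma2 q x =
     qpoch_inf (q\<^sup>2) (q\<^sup>2) / qpoch_inf (q powr (2 * x)) (q\<^sup>2) * (1 - q\<^sup>2) powr (1 - x)"

text \<open>
  Jackson integrals over \<open>[a, \<infinity>)\<close>, \<open>(-\<infinity>, -a]\<close>, \<open>[0, a]\<close> and \<open>(-\<infinity>, 0]\<close>,
  for \<open>a\<close> an integer power of \<open>q\<close>. In the first of them the point \<open>a\<close> itself is not a node.
\<close>

definition jackson_ge :: "real \<Rightarrow> real \<Rightarrow> (real \<Rightarrow> complex) \<Rightarrow> complex" where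
  "jackson_ge q a f =
     of_real ((1 - q) * a) *
     (\<Sum>\<^sub>\<infinity>n\<in>{..-1::int}. of_real (q powi n) * f (a * q powi n))"

definition jackson_le_neg :: "real \<Rightarrow> real \<Rightarrow> (real \<Rightarrow> complex) \<Rightarrow> complex" where
  "jackson_le_neg q a f = jackson_ge q a (\<lambda>x. f (- x))"

definition jackson_0_to :: "real \<Rightarrow> real \<Rightarrow> (real \<Rightarrow> complex) \<Rightarrow> complex" where
  "jackson_0_to q a f =
     of_real ((1 - q) * a) *
     (\<Sum>\<^sub>\<infinity>n\<in>{0::int..}. of_real (q powi n) * f (a * q powi n))"

definition jackson_le_0 :: "real \<Rightarrow> (real \<Rightarrow> complex) \<Rightarrow> complex" where
  "jackson_le_0 q f =
     of_real (1 - q) * (\<Sum>\<^sub>\<infinity>n\<in>(UNIV::int set). of_real (q powi n) * f (- (q powi n)))"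

text \<open>The integral over \<open>(-\<infinity>, b]\<close> for a lattice point \<open>b\<close> of either sign.\<close>

definition jackson_le :: "real \<Rightarrow> real \<Rightarrow> (real \<Rightarrow> complex) \<Rightarrow> complex" where
  "jackson_le q b f =
     (if b < 0 then jackson_le_neg q (- b) f else jackson_le_0 q f + jackson_0_to q b f)"

definition jackson_abs_ge :: "real \<Rightarrow> real \<Rightarrow> (real \<Rightarrow> complex) \<Rightarrow> complex" where
  "jackson_abs_ge q a f = jackson_ge q a (\<lambda>x. f x + f (- x))"

text \<open>
  Rubin's \<open>q\<close>-derivative, meant for \<open>z \<noteq> 0\<close>: it is \<open>(f(z/q) - f(z)) / ((1 - q) z)\<close> on even \<open>f\<close>
  and \<open>(f(z) - f(q z)) / ((1 - q) z)\<close> on odd \<open>f\<close>.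
\<close>

definition dq :: "real \<Rightarrow> (real \<Rightarrow> complex) \<Rightarrow> real \<Rightarrow> complex" where
  "dq q f z =
     (f (inverse q * z) + f (- (inverse q * z)) - f (q * z) + f (- (q * z)) - 2 * f (- z))
     / of_real (2 * (1 - q) * z)"

definition Eq_space :: "real \<Rightarrow> (real \<Rightarrow> complex) set" where
  "Eq_space q =
     {f. \<forall>n::nat.
        (\<forall>a::real\<ge>0. bdd_above {norm ((dq q ^^ k) f x) |k x. k \<le> n \<and> x \<in> {-a..a} \<inter> Rq q}) \<and>
        (\<exists>l. ((dq q ^^ n) f \<longlongrightarrow> l) (at 0 within Rq q))}"

definition Dq_space :: "real \<Rightarrow> (real \<Rightarrow> complex) set" where
  "Dq_space q = {f \<in> Eq_space q. \<exists>M::real. \<forall>x\<in>Rq q. \<bar>x\<bar> > M \<longrightarrow> f x = 0}"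

definition Wker :: "real \<Rightarrow> real \<Rightarrow> real \<Rightarrow> real" where
  "Wker q \<alpha> t =
     qpoch_inf (t\<^sup>2 * q\<^sup>2) (q\<^sup>2) / qpoch_inf (t\<^sup>2 * q powr (2 * \<alpha> + 1)) (q\<^sup>2)"

text \<open>
  The \<open>q\<close>-Weyl operator. Its domain consists of the even members of \<open>Dq_space q\<close>;
  this is not enforced by the definition.
\<close>

definition tR :: "real \<Rightarrow> real \<Rightarrow> (real \<Rightarrow> complex) \<Rightarrow> real \<Rightarrow> complex" where
  "tR q \<alpha> f t =
     of_real ((1 + q) powr (- \<alpha> + 1/2) / qGamma2 q (\<alpha> + 1/2)) *
     jackson_ge q (q * \<bar>t\<bar>) (\<lambda>x. of_real (Wker q \<alpha> (t / x)) * f x * of_real (x powr (2 * \<alpha>)))"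

text \<open>
  Dual of the intertwining operator \<open>V\<^sub>\<alpha>\<close>; the sum runs over the lattice points with \<open>\<bar>x\<bar> \<ge> \<bar>t\<bar>\<close>.
\<close>

definition tV :: "real \<Rightarrow> real \<Rightarrow> (real \<Rightarrow> complex) \<Rightarrow> real \<Rightarrow> complex" where
  "tV q \<alpha> f t =
     of_real ((1 + q) powr (- \<alpha> + 1/2) / (2 * qGamma2 q (\<alpha> + 1/2))) *
     jackson_abs_ge q (q * \<bar>t\<bar>)
       (\<lambda>x. of_real (Wker q \<alpha> (t / x)) * of_real (1 + t / x) * f x * of_real (\<bar>x\<bar> powr (2 * \<alpha>)))"

definition Jq :: "real \<Rightarrow> (real \<Rightarrow> complex) \<Rightarrow> real \<Rightarrow> complex" where
  "Jq q f x = jackson_le q (q * x) f"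

end

theory Submission imports Defs begin

text \<open>
  All sums over \<open>\<bar>x\<bar> \<ge> \<bar>t\<bar>\<close> are finite, with nodes \<open>x\<^sub>m = \<bar>t\<bar> / q ^ m\<close>, and the even part of \<open>f\<close>
  contributes the first summand at once. For the odd part \<open>g\<close>, the function \<open>h = Jq q g\<close> is
  minus the Jackson integral of \<open>g\<close> from \<open>x\<close> to infinity, so that
  \<open>h x\<^sub>m - h x\<^bsub>m+1\<^esub> = - (1 - q) x\<^sub>m g x\<^sub>m\<close>. The \<open>q\<close>-derivative of the Weyl transform of \<open>h\<close> is
  then evaluated by summation by parts. With \<open>w\<^sub>m = Wker q \<alpha> (q ^ m)\<close> and \<open>w\<^bsub>-1\<^esub> = 0\<close>, what makes this work
  is the recurrence \<open>(1 - q\<^sup>2\<^sup>m) w\<^sub>m = (1 - q\<^bsup>2m+2\<alpha>-1\<^esup>) w\<^bsub>m-1\<^esub>\<close>, which says that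
  \<open>x\<^sub>m\<^bsup>2\<alpha>+1\<^esup> (w\<^sub>m - w\<^bsub>m-1\<^esub>)\<close> is the difference of the sequence \<open>t\<^sup>2 x\<^sub>m\<^bsup>2\<alpha>-1\<^esup> w\<^sub>m\<close>.
\<close>

section \<open>The kernel at powers of \<open>q\<close>\<close>

lemma qpoch_inf_rec:
  assumes "\<bar>p\<bar> < 1"
  shows "qpoch_inf a p = (1 - a) * qpoch_inf (a * p) p"
proof -
  have "summable (\<lambda>k. norm ((1 - a * p ^ k) - 1))"
    using assms by (simp add: abs_mult power_abs summable_mult summable_geometric)
  then have "convergent_prod (\<lambda>k. 1 - a * p ^ k)"
    by (intro abs_convergent_prod_imp_convergent_prod summable_imp_abs_convergent_prod)
  from has_prod_ignore_initial_segment'[OF this, of 1]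
  show ?thesis
    unfolding qpoch_inf_def by (simp add: has_prod_iff mult.assoc)
qed

text \<open>Passing from \<open>q ^ m\<close> to \<open>q ^ Suc m\<close> drops the first factor of
  each infinite product in the kernel. The dropped denominator factor is nonzero because
  \<open>\<alpha> > - 1/2\<close> keeps \<open>q powr (2 * \<alpha> + 1)\<close> below 1.\<close>

lemma Wker_power_Suc:
  assumes q: "0 < q" "q < 1" and \<alpha>: "\<alpha> > - 1/2"
  shows "Wker q \<alpha> (q ^ Suc m) * (1 - q ^ (2 * Suc m)) =
    Wker q \<alpha> (q ^ m) * (1 - q ^ (2 * m) * q powr (2 * \<alpha> + 1))"
proof -
  define A where "A = q ^ (2 * Suc m)"
  define B where "B = q ^ (2 * m) * q powr (2 * \<alpha> + 1)"
  have p: "\<bar>q\<^sup>2\<bar> < 1"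
    using q by (simp add: power_less_one_iff abs_square_less_1)
  have "q powr (2 * \<alpha> + 1) < 1"
    using q \<alpha> powr_less_mono'[of q 0 "2 * \<alpha> + 1"] by simp
  then have "B < 1"
    unfolding B_def using q
    by (meson le_less_trans less_imp_le mult_left_le_one_le power_le_one powr_ge_zero zero_le_power)
  have sq: "(q ^ n)\<^sup>2 = q ^ (2 * n)" for n
    by (simp add: power_mult [symmetric] mult.commute)
  have "Wker q \<alpha> (q ^ m) = qpoch_inf A (q\<^sup>2) / qpoch_inf B (q\<^sup>2)"
    unfolding Wker_def A_def B_def sq by (simp add: power2_eq_square algebra_simps)
  also have "\<dots> = (1 - A) * qpoch_inf (A * q\<^sup>2) (q\<^sup>2) / ((1 - B) * qpoch_inf (B * q\<^sup>2) (q\<^sup>2))"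
    by (simp only: qpoch_inf_rec[OF p, symmetric])
  also have "\<dots> = (1 - A) / (1 - B) * Wker q \<alpha> (q ^ Suc m)"
    unfolding Wker_def A_def B_def sq by (simp add: power2_eq_square algebra_simps)
  finally show ?thesis
    using \<open>B < 1\<close> unfolding A_def[symmetric] B_def[symmetric] by (simp add: field_simps)
qed

lemma Wker_minus: "Wker q \<alpha> (- t) = Wker q \<alpha> t"
  by (simp add: Wker_def)

lemma Wker_abs: "Wker q \<alpha> (\<bar>t\<bar> / x) = Wker q \<alpha> (t / x)"
  by (simp add: Wker_def power_divide)

section \<open>Jackson integrals as sums over exponents\<close>

text \<open>The base point \<open>q * b\<close> is not a node; the first node, at exponent -1, is
  \<open>b\<close>. Counting outward by \<open>- 1 - int n\<close> turns the nodes into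
  \<open>b / q ^ n\<close>, and the vanishing of \<open>F\<close> truncates the sum.\<close>

lemma jackson_ge_eq_sum:
  assumes q: "0 < q" and supp: "\<And>n::nat. n \<ge> N \<Longrightarrow> F (b / q ^ n) = 0"
  shows "jackson_ge q (q * b) F =
    of_real (1 - q) * (\<Sum>n<N. of_real (b / q ^ n) * F (b / q ^ n))"
proof -
  define G where "G n = of_real (q powi n) * F (q * b * q powi n)" for n :: int
  have bij: "bij_betw (\<lambda>n::nat. - 1 - int n) UNIV {..-1}"
    by (rule bij_betwI[where g = "\<lambda>n. nat (- 1 - n)"]) auto
  have node: "q powi (- 1 - int n) = 1 / (q * q ^ n)" for n
    using q by (simp add: power_int_diff power_int_minus field_simps)
  have G: "G (- 1 - int n) = of_real (1 / (q * q ^ n)) * F (b / q ^ n)" for n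
    unfolding G_def node using q by simp
  have "infsum G {..-1} = infsum (\<lambda>n::nat. G (- 1 - int n)) UNIV"
    by (rule infsum_reindex_bij_betw[OF bij, symmetric])
  also have "\<dots> = infsum (\<lambda>n. G (- 1 - int n)) {..<N}"
    by (rule infsum_cong_neutral) (auto simp: G supp)
  also have "\<dots> = (\<Sum>n<N. of_real (1 / (q * q ^ n)) * F (b / q ^ n))"
    by (simp add: G)
  finally show ?thesis
    unfolding jackson_ge_def G_def[symmetric] using q
    by (simp add: sum_distrib_left mult.assoc)
qed

text \<open>Absorbing the base point into the exponent makes integrals with different endpoints sums
  of one function over different sets of integers.\<close>

lemma jackson_shift:
  assumes "q \<noteq> 0"
  shows "of_real (q powi k) * (\<Sum>\<^sub>\<infinity>n\<in>A. of_real (q powi n) * g (q powi k * q powi n)) =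
    (\<Sum>\<^sub>\<infinity>n\<in>(+) k ` A. of_real (q powi n) * g (q powi n) :: complex)"
proof -
  have "of_real (q powi k) * (\<Sum>\<^sub>\<infinity>n\<in>A. of_real (q powi n) * g (q powi k * q powi n)) =
      (\<Sum>\<^sub>\<infinity>n\<in>A. of_real (q powi (k + n)) * g (q powi (k + n)))"
    using assms by (simp add: infsum_cmult_right'[symmetric] power_int_add mult.assoc)
  then show ?thesis
    by (simp add: infsum_reindex o_def)
qed

lemma jackson_summable_near_0:
  fixes g :: "real \<Rightarrow> complex"
  assumes q: "0 < q" "q < 1" and bound: "\<And>n. n \<ge> k \<Longrightarrow> norm (g (q powi n)) \<le> B"
  shows "(\<lambda>n::int. of_real (q powi n) * g (q powi n)) summable_on {k..}"
proof -
  have bij: "bij_betw (\<lambda>n::nat. k + int n) UNIV {k..}"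
    by (rule bij_betwI[where g = "\<lambda>n. nat (n - k)"]) auto
  have "summable (\<lambda>n. norm (of_real (q powi (k + int n)) * g (q powi (k + int n))))"
  proof (rule summable_comparison_test')
    show "summable (\<lambda>n. (q powi k * B) * q ^ n)"
      using q by (intro summable_mult summable_geometric) auto
    fix n :: nat
    have "norm (g (q powi (k + int n))) \<le> B"
      by (rule bound) simp
    then show "norm (norm (of_real (q powi (k + int n)) * g (q powi (k + int n))))
        \<le> (q powi k * B) * q ^ n"
      using q by (simp add: norm_mult norm_power_int norm_power power_int_add mult_ac)
  qed
  then show ?thesis
    using summable_on_reindex_bij_betw[OF bij] by (blast intro: norm_summable_imp_summable_on)
qed

text \<open>By oddness the integral over the negative half-line is minus the sum over all exponents.
  Adding the integral from 0 to \<open>q powi (j + 1)\<close> cancels the exponents from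
  \<open>j + 1\<close> on and leaves minus the sum over those up to \<open>j\<close>. The bound near
  0 and the support condition justify splitting the full sum.\<close>

lemma Jq_odd:
  fixes g :: "real \<Rightarrow> complex"
  assumes q: "0 < q" "q < 1" and odd: "\<And>y. g (- y) = - g y"
    and bound: "\<And>n. n \<ge> j + 1 \<Longrightarrow> norm (g (q powi n)) \<le> B"
    and supp: "\<And>n. n \<le> K \<Longrightarrow> g (q powi n) = 0"
  shows "Jq q g (q powi j) = - jackson_ge q (q * q powi j) g"
proof -
  define \<phi> where "\<phi> = (\<lambda>n::int. of_real (q powi n) * g (q powi n))"
  have qz: "q * q powi j = q powi (j + 1)"
    using q by (simp add: power_int_add)
  have img: "(+) (j + 1) ` {0..} = {j + 1..}" "(+) (j + 1) ` {..-1} = {..j}"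
    by (auto simp: image_iff intro: bexI[where x = "_ - (j + 1)"])
  have ge: "jackson_ge q (q powi (j + 1)) g = of_real (1 - q) * infsum \<phi> {..j}"
    using jackson_shift[where k = "j + 1" and A = "{..-1}" and g = g and q = q] q
    by (simp add: jackson_ge_def \<phi>_def img mult.assoc)
  have to: "jackson_0_to q (q powi (j + 1)) g = of_real (1 - q) * infsum \<phi> {j + 1..}"
    using jackson_shift[where k = "j + 1" and A = "{0..}" and g = g and q = q] q
    by (simp add: jackson_0_to_def \<phi>_def img mult.assoc)
  have 0: "jackson_le_0 q g = - of_real (1 - q) * infsum \<phi> UNIV"
    by (simp add: jackson_le_0_def odd infsum_uminus \<phi>_def algebra_simps)
  have \<phi>_0: "\<phi> n = 0" if "n < K" for n
    using supp[of n] that by (simp add: \<phi>_def)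
  have "\<phi> summable_on {..j} \<longleftrightarrow> \<phi> summable_on {K..j}"
    by (rule summable_on_cong_neutral) (auto simp: \<phi>_0)
  then have "\<phi> summable_on {..j}"
    by simp
  moreover have "\<phi> summable_on {j + 1..}"
    unfolding \<phi>_def using q bound by (rule jackson_summable_near_0)
  ultimately have "infsum \<phi> ({..j} \<union> {j + 1..}) = infsum \<phi> {..j} + infsum \<phi> {j + 1..}"
    by (intro infsum_Un_disjoint) auto
  moreover have "{..j} \<union> {j + 1..} = UNIV"
    by auto
  ultimately have "infsum \<phi> UNIV = infsum \<phi> {..j} + infsum \<phi> {j + 1..}"
    by simp
  \<comment> \<open>This selects the branch of \<open>jackson_le\<close> for a nonnegative
    endpoint.\<close>
  moreover have "\<not> q powi (j + 1) < 0"
    using q by (simp add: not_less)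
  ultimately show ?thesis
    by (simp only: Jq_def jackson_le_def qz if_False 0 to ge distrib_left mult_minus_left) simp
qed

section \<open>Summation by parts, and the two operators as finite sums\<close>

text \<open>The first hypothesis is the case \<open>n = -1\<close> of the second under the
  convention that \<open>w\<close> and \<open>S\<close> vanish at -1. The boundary term is carried
  along for the induction; it disappears once \<open>h n = 0\<close>.\<close>

lemma summation_by_parts:
  fixes h w P S :: "nat \<Rightarrow> 'a::comm_ring_1"
  assumes "P 0 * w 0 = S 0"
    and "\<And>n. P (Suc n) * (w (Suc n) - w n) = S (Suc n) - S n"
  shows "(\<Sum>m<n. P (Suc m) * w m * h (Suc m)) - (\<Sum>m<n. P m * w m * h m) =
    (P n * w n - S n) * h n - (\<Sum>m<n. S m * (h m - h (Suc m)))"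
proof (induction n)
  case 0
  show ?case using assms(1) by simp
next
  case (Suc n)
  have "(\<Sum>m<Suc n. P (Suc m) * w m * h (Suc m)) - (\<Sum>m<Suc n. P m * w m * h m) =
      ((\<Sum>m<n. P (Suc m) * w m * h (Suc m)) - (\<Sum>m<n. P m * w m * h m)) +
      (P (Suc n) * w n * h (Suc n) - P n * w n * h n)"
    by simp
  also have "\<dots> = (P (Suc n) * w n - S n) * h (Suc n) - (\<Sum>m<Suc n. S m * (h m - h (Suc m)))"
    unfolding Suc.IH by (simp add: left_diff_distrib right_diff_distrib)
  also have "P (Suc n) * w n - S n = P (Suc n) * w (Suc n) - S (Suc n)"
    using assms(2)[of n] by (simp add: algebra_simps)
  finally show ?case .
qed

lemma tR_eq_sum:
  assumes q: "0 < q" and t: "t \<noteq> 0" and supp: "\<And>n. n \<ge> N \<Longrightarrow> h (\<bar>t\<bar> / q ^ n) = 0"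
  shows "tR q \<alpha> h t =
    of_real ((1 + q) powr (- \<alpha> + 1/2) / qGamma2 q (\<alpha> + 1/2)) * (of_real (1 - q) *
      (\<Sum>n<N. of_real (\<bar>t\<bar> / q ^ n * (\<bar>t\<bar> / q ^ n) powr (2 * \<alpha>)) * of_real (Wker q \<alpha> (q ^ n)) *
        h (\<bar>t\<bar> / q ^ n)))"
proof -
  have W: "Wker q \<alpha> (t / (\<bar>t\<bar> / q ^ n)) = Wker q \<alpha> (q ^ n)" for n
    by (subst Wker_abs[symmetric]) (use t q in simp)
  show ?thesis
    unfolding tR_def
    by (subst jackson_ge_eq_sum[where N = N]) (use q supp in \<open>simp_all only: W, simp_all add: mult_ac\<close>)
qed

lemma tR_minus: "tR q \<alpha> h (- t) = tR q \<alpha> h t"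
  by (simp add: tR_def Wker_minus)

text \<open>Pairing \<open>x\<close> with \<open>- x\<close> leaves the even part with factor 1 and
  the odd part with factor \<open>t / x\<close>. The latter turns the Jackson weight
  \<open>x\<close> into \<open>t\<close>.\<close>

lemma tV_eq_even_odd:
  assumes q: "0 < q" and t: "t \<noteq> 0"
    and supp: "\<And>n. n \<ge> N \<Longrightarrow> f (\<bar>t\<bar> / q ^ n) = 0" "\<And>n. n \<ge> N \<Longrightarrow> f (- (\<bar>t\<bar> / q ^ n)) = 0"
  shows "tV q \<alpha> f t = tR q \<alpha> (even_part f) t +
    of_real ((1 + q) powr (- \<alpha> + 1/2) / qGamma2 q (\<alpha> + 1/2)) * (of_real (1 - q) *
      (\<Sum>n<N. of_real (t * (\<bar>t\<bar> / q ^ n) powr (2 * \<alpha>) * Wker q \<alpha> (q ^ n)) *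
        odd_part f (\<bar>t\<bar> / q ^ n)))"
proof -
  define y where "y n = \<bar>t\<bar> / q ^ n" for n
  define C where "C = complex_of_real ((1 + q) powr (- \<alpha> + 1/2) / qGamma2 q (\<alpha> + 1/2))"
  have y: "y n > 0" for n
    using q t by (simp add: y_def)
  have W: "Wker q \<alpha> (t / y n) = Wker q \<alpha> (q ^ n)" for n
    unfolding y_def by (subst Wker_abs[symmetric]) (use t q in simp)
  have Wm: "Wker q \<alpha> (- (t / y n)) = Wker q \<alpha> (q ^ n)" for n
    by (simp add: Wker_minus W)
  have half: "complex_of_real ((1 + q) powr (- \<alpha> + 1/2) / (2 * qGamma2 q (\<alpha> + 1/2))) = C / 2"
    by (simp add: C_def)
  have summand: "complex_of_real (y n) *
      (of_real (Wker q \<alpha> (q ^ n)) * of_real (1 + t / y n) * f (y n) * of_real (\<bar>y n\<bar> powr (2 * \<alpha>)) +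
       of_real (Wker q \<alpha> (q ^ n)) * of_real (1 + - (t / y n)) * f (- y n) * of_real (\<bar>y n\<bar> powr (2 * \<alpha>))) =
      2 * (of_real (y n * y n powr (2 * \<alpha>)) * of_real (Wker q \<alpha> (q ^ n)) * even_part f (y n) +
       of_real (t * y n powr (2 * \<alpha>) * Wker q \<alpha> (q ^ n)) * odd_part f (y n))" for n
    using y[of n] by (simp add: even_part_def odd_part_def field_simps)
  have "tV q \<alpha> f t = C / 2 * (of_real (1 - q) * (\<Sum>n<N. complex_of_real (y n) *
      (of_real (Wker q \<alpha> (q ^ n)) * of_real (1 + t / y n) * f (y n) * of_real (\<bar>y n\<bar> powr (2 * \<alpha>)) +
       of_real (Wker q \<alpha> (q ^ n)) * of_real (1 + - (t / y n)) * f (- y n) * of_real (\<bar>y n\<bar> powr (2 * \<alpha>)))))"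
    unfolding tV_def jackson_abs_ge_def half
    by (subst jackson_ge_eq_sum[where N = N])
      (use q supp in \<open>simp_all only: y_def[symmetric] W Wm divide_minus_right abs_minus_cancel, simp_all\<close>)
  also have "\<dots> = C * (of_real (1 - q) *
      (\<Sum>n<N. of_real (y n * y n powr (2 * \<alpha>)) * of_real (Wker q \<alpha> (q ^ n)) * even_part f (y n))) +
    C * (of_real (1 - q) *
      (\<Sum>n<N. of_real (t * y n powr (2 * \<alpha>) * Wker q \<alpha> (q ^ n)) * odd_part f (y n)))"
    unfolding summand sum_distrib_left[symmetric] sum.distrib by (simp add: algebra_simps)
  also have "C * (of_real (1 - q) *
      (\<Sum>n<N. of_real (y n * y n powr (2 * \<alpha>)) * of_real (Wker q \<alpha> (q ^ n)) * even_part f (y n)))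
      = tR q \<alpha> (even_part f) t"
    unfolding C_def y_def by (rule tR_eq_sum[symmetric]) (use q t supp in \<open>auto simp: even_part_def\<close>)
  finally show ?thesis
    by (simp only: C_def y_def)
qed

text \<open>The transform is even, so \<open>dq\<close> reduces to the difference of its values at
  \<open>t / q\<close> and \<open>t\<close>, divided by \<open>(1 - q) * t\<close>. Both values are
  sums over the same chain of nodes, offset by one, which is the setting of
  \<open>summation_by_parts\<close>.\<close>

lemma dq_tR_eq_sum:
  assumes q: "0 < q" "q < 1" and \<alpha>: "\<alpha> > - 1/2" and t: "t \<noteq> 0"
    and h: "\<And>n. h (\<bar>t\<bar> / q ^ n) = - jackson_ge q (q * (\<bar>t\<bar> / q ^ n)) g"
    and supp: "\<And>n. n \<ge> N \<Longrightarrow> g (\<bar>t\<bar> / q ^ n) = 0"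
  shows "dq q (tR q \<alpha> h) t =
    of_real ((1 + q) powr (- \<alpha> + 1/2) / qGamma2 q (\<alpha> + 1/2)) * (of_real (1 - q) *
      (\<Sum>n<N. of_real (t * (\<bar>t\<bar> / q ^ n) powr (2 * \<alpha>) * Wker q \<alpha> (q ^ n)) * g (\<bar>t\<bar> / q ^ n)))"
proof -
  define y where "y n = \<bar>t\<bar> / q ^ n" for n
  define w where "w n = Wker q \<alpha> (q ^ n)" for n
  define P where "P n = y n * y n powr (2 * \<alpha>)" for n
  define S where "S n = w n * t\<^sup>2 / y n * y n powr (2 * \<alpha>)" for n
  define C where "C = complex_of_real ((1 + q) powr (- \<alpha> + 1/2) / qGamma2 q (\<alpha> + 1/2))"
  have y: "y n > 0" for n
    using q t by (simp add: y_def)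
  have yadd: "y m / q ^ n = y (m + n)" for m n
    by (simp add: y_def power_add)
  have y_Suc: "y (Suc n) = y n / q" for n
    by (simp add: y_def)
  \<comment> \<open>The length \<open>k\<close> is left free so that sums started at neighbouring
    nodes can be made to end at the same node.\<close>
  have hsum: "h (y m) = - of_real (1 - q) * (\<Sum>n<k. of_real (y (m + n)) * g (y (m + n)))"
    if "m + k \<ge> N" for m k
    unfolding h[folded y_def]
    by (subst jackson_ge_eq_sum[where N = k])
      (use q supp that in \<open>auto simp: yadd y_def[symmetric] left_diff_distrib\<close>)
  have h0: "h (y m) = 0" if "m \<ge> N" for m
    using hsum[of m 0] that by simp
  have hdiff: "h (y m) - h (y (Suc m)) = - of_real ((1 - q) * y m) * g (y m)" for m
    using hsum[of m "Suc N"] hsum[of "Suc m" N]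
    by (simp only: sum.lessThan_Suc_shift) (simp add: algebra_simps)
  have S_Suc: "P (Suc n) * (w (Suc n) - w n) = S (Suc n) - S n" for n
  proof -
    define r where "r = q powr (2 * \<alpha>)"
    have r: "r > 0" "q powr (2 * \<alpha> + 1) = r * q"
      using q by (simp_all add: r_def powr_add)
    have yr: "(y n / q) powr (2 * \<alpha>) = y n powr (2 * \<alpha>) / r"
      using q y[of n] by (simp add: powr_divide r_def)
    have t2: "t\<^sup>2 = (y n)\<^sup>2 * q ^ (2 * n)"
      using q by (simp add: y_def power_divide power_mult mult.commute[of 2] power2_eq_square)
    have rec: "w (Suc n) * (1 - q\<^sup>2 * q ^ (2 * n)) = w n * (1 - q ^ (2 * n) * (r * q))"
      using Wker_power_Suc[OF q \<alpha>, of n] unfolding r w_def by (simp add: power2_eq_square mult.assoc)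
    \<comment> \<open>Multiplying by \<open>r * q\<close>, that is
      \<open>q powr (2 * \<alpha> + 1)\<close>, clears the denominators coming from
      \<open>y (Suc n)\<close>; the last bracket is zero by \<open>rec\<close>.\<close>
    have "(P (Suc n) * (w (Suc n) - w n) - (S (Suc n) - S n)) * (r * q) =
        y n * y n powr (2 * \<alpha>) * (w (Suc n) * (1 - q\<^sup>2 * q ^ (2 * n)) - w n * (1 - q ^ (2 * n) * (r * q)))"
      unfolding P_def S_def y_Suc yr t2 using q y[of n] r(1)
      by (simp add: field_simps power2_eq_square)
    with rec q r show ?thesis by simp
  qed
  have S0: "P 0 * w 0 = S 0"
    using t by (simp add: P_def S_def y_def power2_eq_square field_simps abs_mult_self_eq)
  define H where "H = tR q \<alpha> h"
  have Ht: "H t = C * (of_real (1 - q) * (\<Sum>n<N. of_real (P n) * of_real (w n) * h (y n)))"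
    unfolding H_def C_def P_def w_def y_def
    by (rule tR_eq_sum) (use q t h0 in \<open>auto simp: y_def\<close>)
  have shift: "\<bar>inverse q * t\<bar> / q ^ n = y (Suc n)" for n
    using q by (simp add: y_def abs_mult field_simps)
  \<comment> \<open>The nodes move to \<open>y (Suc n)\<close>, but the kernel depends only on the
    ratio and keeps the values \<open>w n\<close>.\<close>
  have Htq: "H (inverse q * t) =
      C * (of_real (1 - q) * (\<Sum>n<N. of_real (P (Suc n)) * of_real (w n) * h (y (Suc n))))"
    unfolding H_def C_def P_def w_def shift[symmetric]
    by (rule tR_eq_sum) (use q t h0 in \<open>auto simp: shift simp del: abs_mult\<close>)
  have "H (inverse q * t) - H t = C * (of_real (1 - q) *
      ((\<Sum>n<N. of_real (P (Suc n)) * of_real (w n) * h (y (Suc n))) -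
       (\<Sum>n<N. of_real (P n) * of_real (w n) * h (y n))))"
    unfolding Ht Htq by (simp add: algebra_simps)
  \<comment> \<open>The boundary term vanishes since \<open>h (y N) = 0\<close>.\<close>
  also have "\<dots> = C * (of_real (1 - q) * (- (\<Sum>n<N. of_real (S n) * (h (y n) - h (y (Suc n))))))"
    by (subst summation_by_parts[where S = "\<lambda>n. of_real (S n)"])
      (simp_all add: h0 S0 S_Suc flip: of_real_mult of_real_diff)
  also have "- (\<Sum>n<N. of_real (S n) * (h (y n) - h (y (Suc n)))) =
      of_real ((1 - q) * t) * (\<Sum>n<N. of_real (t * y n powr (2 * \<alpha>) * w n) * g (y n))"
    unfolding hdiff sum_distrib_left sum_negf[symmetric]
    by (intro sum.cong refl) (use y in \<open>simp add: S_def power2_eq_square field_simps less_imp_neq[symmetric]\<close>)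
  finally have diff: "H (inverse q * t) - H t = of_real ((1 - q) * t) * (C * (of_real (1 - q) *
      (\<Sum>n<N. of_real (t * y n powr (2 * \<alpha>) * w n) * g (y n))))"
    by (simp only: mult_ac)
  have "dq q H t = (H (inverse q * t) - H t) / of_real ((1 - q) * t)"
    using q t by (simp add: dq_def H_def tR_minus field_simps)
  also have "\<dots> = C * (of_real (1 - q) * (\<Sum>n<N. of_real (t * y n powr (2 * \<alpha>) * w n) * g (y n)))"
    unfolding diff using q t by simp
  finally show ?thesis
    by (simp only: H_def C_def y_def w_def)
qed

section \<open>The identity at a lattice point\<close>

theorem theorem8:
  fixes q \<alpha> :: real and f :: "real \<Rightarrow> complex" and x :: real
  assumes "0 < q" and "q < 1"
    and "\<exists>m::int. ln (1 - q) / ln q = 2 * of_int m"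
    and "\<alpha> > - 1/2"
    and "f \<in> Dq_space q"
    and "x \<in> Rq q"
  shows "tV q \<alpha> f x = tR q \<alpha> (even_part f) x + dq q (tR q \<alpha> (Jq q (odd_part f))) x"
proof -
  note q = assms(1,2)
  obtain j where j: "x = q powi j \<or> x = - (q powi j)"
    using assms(6) by (auto simp: Rq_def)
  have x: "\<bar>x\<bar> = q powi j" "x \<noteq> 0"
    using j zero_less_power_int[OF q(1), of j] by auto
  have Rq: "q powi n \<in> Rq q" "- (q powi n) \<in> Rq q" for n
    by (auto simp: Rq_def)
  have node: "\<bar>x\<bar> / q ^ n = q powi (j - int n)" for n
    using q by (simp add: x power_int_diff)
  obtain M where M: "\<And>y. y \<in> Rq q \<Longrightarrow> \<bar>y\<bar> > M \<Longrightarrow> f y = 0"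
    using assms(5) by (auto simp: Dq_space_def)
  \<comment> \<open>From index \<open>N\<close> on, the nodes exceed the support bound
    \<open>M\<close>.\<close>
  obtain N where N: "M / \<bar>x\<bar> < (1 / q) ^ N"
    using real_arch_pow[of "1 / q" "M / \<bar>x\<bar>"] q by auto
  have large: "\<bar>q powi n\<bar> > M" if "n \<le> j - int N" for n
  proof -
    have "M < \<bar>x\<bar> / q ^ N"
      using N q x by (simp add: field_simps power_divide)
    also have "\<dots> \<le> q powi n"
      unfolding node using q that by (intro power_int_decreasing) auto
    finally show ?thesis by simp
  qed
  have supp: "f (q powi n) = 0" "f (- (q powi n)) = 0" if "n \<le> j - int N" for n
    using M[of "q powi n"] M[of "- (q powi n)"] Rq large[OF that] by auto
  have odd_supp: "odd_part f (q powi n) = 0" if "n \<le> j - int N" for n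
    using supp[OF that] by (simp add: odd_part_def)
  \<comment> \<open>Only the zeroth iterate of \<open>dq\<close> in \<open>Eq_space\<close> is used,
    which is \<open>f\<close> itself.\<close>
  have bounded: "\<exists>B. \<forall>y \<in> {-a..a} \<inter> Rq q. norm (f y) \<le> B" if "a \<ge> 0" for a
  proof -
    have "f \<in> Eq_space q"
      using assms(5) by (simp add: Dq_space_def)
    then have "\<forall>a\<ge>0. bdd_above {norm ((dq q ^^ k) f y) |k y. k \<le> 0 \<and> y \<in> {-a..a} \<inter> Rq q}"
      unfolding Eq_space_def mem_Collect_eq by (rule spec[where x = 0, THEN conjunct1])
    from this[rule_format, OF that] obtain B where
      "\<And>v. v \<in> {norm ((dq q ^^ k) f y) |k y. k \<le> 0 \<and> y \<in> {-a..a} \<inter> Rq q} \<Longrightarrow> v \<le> B"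
      by (auto simp: bdd_above_def)
    from this[OF CollectI] show ?thesis
      by (intro exI[of _ B] ballI) (force intro!: exI[of _ "0::nat"])
  qed
  have Jq: "Jq q (odd_part f) (q powi k) = - jackson_ge q (q * q powi k) (odd_part f)" for k
  proof -
    obtain B where B: "\<And>y. y \<in> {- (q powi (k + 1))..q powi (k + 1)} \<inter> Rq q \<Longrightarrow> norm (f y) \<le> B"
      using bounded[of "q powi (k + 1)"] q by (meson less_imp_le zero_le_power_int)
    show ?thesis
    proof (rule Jq_odd[OF q, where B = B and K = "j - int N"])
      show "odd_part f (- y) = - odd_part f y" for y
        by (simp add: odd_part_def field_simps)
      show "odd_part f (q powi n) = 0" if "n \<le> j - int N" for n
        using that by (rule odd_supp)
      fix n :: int assume n: "n \<ge> k + 1"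
      have "q powi n \<le> q powi (k + 1)" "q powi n > 0"
        using q n by (auto intro: power_int_decreasing)
      then have "norm (f (q powi n)) \<le> B" "norm (f (- (q powi n))) \<le> B"
        using Rq by (auto intro!: B)
      then show "norm (odd_part f (q powi n)) \<le> B"
        using norm_triangle_ineq4[of "f (q powi n)" "f (- (q powi n))"]
        by (simp add: odd_part_def norm_divide)
    qed
  qed
  \<comment> \<open>The derivative equals the very sum that the odd part contributes to
    \<open>tV\<close>.\<close>
  have "dq q (tR q \<alpha> (Jq q (odd_part f))) x =
    of_real ((1 + q) powr (- \<alpha> + 1/2) / qGamma2 q (\<alpha> + 1/2)) * (of_real (1 - q) *
      (\<Sum>n<N. of_real (x * (\<bar>x\<bar> / q ^ n) powr (2 * \<alpha>) * Wker q \<alpha> (q ^ n)) *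
        odd_part f (\<bar>x\<bar> / q ^ n)))"
    by (rule dq_tR_eq_sum[OF q assms(4) x(2)]) (simp_all add: node Jq odd_supp)
  moreover have "tV q \<alpha> f x = tR q \<alpha> (even_part f) x +
    of_real ((1 + q) powr (- \<alpha> + 1/2) / qGamma2 q (\<alpha> + 1/2)) * (of_real (1 - q) *
      (\<Sum>n<N. of_real (x * (\<bar>x\<bar> / q ^ n) powr (2 * \<alpha>) * Wker q \<alpha> (q ^ n)) *
        odd_part f (\<bar>x\<bar> / q ^ n)))"
    by (rule tV_eq_even_odd[OF q(1) x(2)]) (simp_all add: node supp)
  ultimately show ?thesis
    by simp
qed

end
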